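(* Let $n\ge 2$ and let $\mathcal{T}$ be the linear space of all vector fields $X=\sum_{i=1}^n a_iX_i+\sum_{1\le i<j\le n}b_{ij}Y_{ij}$ on $N_{n,2}$, with $a_i,b_{ij}$ smooth functions of $(\vec x,\vec y)$, that commute with the sub-Laplacian, i.e. $[\Delta,X]=0$. Then $\mathcal{T}$ is the set of linear combinations with constant (real) coefficients of the vector fields $\hat X_i$ ($1\le i\le n$), $Y_{ij}$ and $\theta_{ij}$ ($1\le i<j\le n$): $$\mathcal{T}=\mathrm{span}_{\mathbb{R}}\{\hat X_i\ (1\le i\le n),\ Y_{ij},\ \theta_{ij}\ (1\le i<j\le n)\}.$$
   Context: Let $n\ge 2$. $N_{n,2}$ is the simply connected nilpotent Lie group of rank (step) two with $n$ generators, identified with $\mathbb{R}^{n}\times\mathbb{R}^{n(n-1)/2}$ with coordinates $(\vec x,\vec y)=\big((x_i)_{1\le i\le n},(y_{ij})_{1\le i<j\le n}\big)$. Write $\partial_i=\partial/\partial x_i$, $\hat\partial_{ij}=\partial/\partial y_{ij}$ for $i<j$. Define, for $1\le i\le n$, $$X_i=\partial_i+\tfrac12\Big(\sum_{k<i}x_k\hat\partial_{ki}-\sum_{k>i}x_k\hat\partial_{ik}\Big),\qquad \hat X_i=\partial_i-\tfrac12\Big(\sum_{k<i}x_k\hat\partial_{ki}-\sum_{k>i}x_k\hat\partial_{ik}\Big),$$ and, for $1\le i<j\le n$, $Y_{ij}=\hat\partial_{ij}=[X_i,X_j]$ and $$\theta_{ij}=x_j\partial_i-x_i\partial_j+\sum_{1\le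 k<i}(y_{kj}\hat\partial_{ki}-y_{ki}\hat\partial_{kj})+\sum_{i<k<j}(y_{ik}\hat\partial_{kj}-y_{kj}\hat\partial_{ik})+\sum_{j<k\le n}(y_{jk}\hat\partial_{ik}-y_{ik}\hat\partial_{jk}).$$ The sub-Laplacian is $\Delta=\sum_{i=1}^n X_i^2$. *)

theory Defs
  imports "HOL-Analysis.Analysis"
begin

text \<open>The generators are indexed by a finite linearly ordered type with at least two elements,
  so that \<open>n = CARD('n)\<close> is an arbitrary integer \<open>\<ge> 2\<close>. The bound is part of the class because
  the index type of the coordinates \<open>y\<^sub>i\<^sub>j\<close> below has to be inhabited.\<close>

class generator_index = finite + linorder +
  assumes two_le_card: "2 \<le> card (UNIV :: 'a set)"

instance bit0 :: (finite) generator_index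
proof
  have "0 < CARD('a)" by simp
  then show "2 \<le> CARD('a bit0)" by simp
qed

instance bit1 :: (finite) generator_index
proof
  have "0 < CARD('a)" by simp
  then show "2 \<le> CARD('a bit1)" by simp
qed

lemma generator_index_less_ex: "\<exists>i j :: 'n::generator_index. i < j"
proof -
  have "\<not> CARD('n) \<le> Suc 0"
    using two_le_card[where 'a = 'n] by simp
  then obtain i j :: 'n where "i \<noteq> j"
    by (auto simp: card_le_Suc0_iff_eq)
  then show ?thesis
    by (meson neq_iff)
qed

typedef (overloaded) ('n::generator_index) ypair = "{(i, j). i < j} :: ('n \<times> 'n) set"
  using generator_index_less_ex by auto

instance ypair :: (generator_index) finite
proof
  show "finite (UNIV :: 'a ypair set)"
    by (rule finite_imageD[of Rep_ypair])
       (auto intro: finite_subset[OF subset_UNIV] simp: inj_on_def Rep_ypair_inject)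
qed

text \<open>A point of \<open>N\<^sub>n\<^sub>,\<^sub>2\<close> in the global coordinates \<open>(x, y)\<close>. A vector field is given by its
  coefficients with respect to the coordinate fields \<open>\<partial>\<^sub>i\<close> and \<open>\<partial>\<^sub>i\<^sub>j\<close>, that is, as a map into the
  same coordinate space.\<close>

type_synonym 'n nil = "(real ^ 'n) \<times> (real ^ 'n ypair)"
type_synonym 'n vfield = "'n nil \<Rightarrow> 'n nil"

definition xc :: "'n::generator_index nil \<Rightarrow> 'n \<Rightarrow> real" where
  "xc p i = fst p $ i"

text \<open>The functions \<open>yc\<close>, \<open>dy\<close>, \<open>Y\<close> and \<open>\<theta>\<close> are only meaningful, and only used, for indices
  \<open>i < j\<close>.\<close>

definition yc :: "'n::generator_index nil \<Rightarrow> 'n \<Rightarrow> 'n \<Rightarrow> real" where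
  "yc p i j = snd p $ Abs_ypair (i, j)"

definition dx :: "'n::generator_index \<Rightarrow> 'n nil" where
  "dx i = (axis i 1, 0)"

definition dy :: "'n::generator_index \<Rightarrow> 'n \<Rightarrow> 'n nil" where
  "dy i j = (0, axis (Abs_ypair (i, j)) 1)"

definition X :: "'n::generator_index \<Rightarrow> 'n vfield" where
  "X i p = dx i + (1/2) *\<^sub>R ((\<Sum>k\<in>{..<i}. xc p k *\<^sub>R dy k i) - (\<Sum>k\<in>{i<..}. xc p k *\<^sub>R dy i k))"

definition Xhat :: "'n::generator_index \<Rightarrow> 'n vfield" where
  "Xhat i p = dx i - (1/2) *\<^sub>R ((\<Sum>k\<in>{..<i}. xc p k *\<^sub>R dy k i) - (\<Sum>k\<in>{i<..}. xc p k *\<^sub>R dy i k))"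

definition Y :: "'n::generator_index \<Rightarrow> 'n \<Rightarrow> 'n vfield" where
  "Y i j p = dy i j"

definition \<theta> :: "'n::generator_index \<Rightarrow> 'n \<Rightarrow> 'n vfield" where
  "\<theta> i j p = xc p j *\<^sub>R dx i - xc p i *\<^sub>R dx j
    + (\<Sum>k\<in>{..<i}. yc p k j *\<^sub>R dy k i - yc p k i *\<^sub>R dy k j)
    + (\<Sum>k\<in>{i<..<j}. yc p i k *\<^sub>R dy k j - yc p k j *\<^sub>R dy i k)
    + (\<Sum>k\<in>{j<..}. yc p j k *\<^sub>R dy i k - yc p i k *\<^sub>R dy j k)"

text \<open>\<open>Ck k f\<close>: all iterated directional derivatives of \<open>f\<close> of order \<open>< k\<close> are differentiable
  everywhere and those of order \<open>k\<close> are continuous.\<close>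

fun Ck :: "nat \<Rightarrow> ('a::real_normed_vector \<Rightarrow> real) \<Rightarrow> bool" where
  "Ck 0 f \<longleftrightarrow> continuous_on UNIV f"
| "Ck (Suc k) f \<longleftrightarrow>
     (\<forall>p. f differentiable (at p)) \<and> (\<forall>v. Ck k (\<lambda>p. frechet_derivative f (at p) v))"

definition smooth :: "('a::real_normed_vector \<Rightarrow> real) \<Rightarrow> bool" where
  "smooth f \<longleftrightarrow> (\<forall>k. Ck k f)"

type_synonym 'n operator = "('n nil \<Rightarrow> real) \<Rightarrow> ('n nil \<Rightarrow> real)"

definition vf_op :: "'n::generator_index vfield \<Rightarrow> 'n operator" where
  "vf_op V f = (\<lambda>p. frechet_derivative f (at p) (V p))"

definition sub_laplacian :: "'n::generator_index operator" where
  "sub_laplacian f = (\<lambda>p. \<Sum>i\<in>UNIV. vf_op (X i) (vf_op (X i) f) p)"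

definition commutator :: "'n::generator_index operator \<Rightarrow> 'n operator \<Rightarrow> 'n operator" where
  "commutator A B f = (\<lambda>p. A (B f) p - B (A f) p)"

text \<open>Operators are compared on smooth functions only: on other functions the Frechet derivative
  may be an arbitrary value.\<close>

definition T :: "'n::generator_index vfield set" where
  "T = {V. (\<exists>a b. (\<forall>i. smooth (a i)) \<and> (\<forall>i j. i < j \<longrightarrow> smooth (b i j)) \<and>
             V = (\<lambda>p. (\<Sum>i\<in>UNIV. a i p *\<^sub>R X i p) + (\<Sum>(i, j)\<in>{(i, j). i < j}. b i j p *\<^sub>R Y i j p))) \<and>
           (\<forall>f. smooth f \<longrightarrow> commutator sub_laplacian (vf_op V) f = (\<lambda>p. 0))}"

end

(* Let Z_k be the operator of X_k. Comparing second-order parts, the field sum a_i X_i + sum b_ij Y_ij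
   commutes with the sub-Laplacian only if
     Z_k a_i + Z_i a_k = 0  and  Z_k b_ij = delta_kj a_i - delta_ki a_j,
   with b extended skew-symmetrically. Since Y_kl = [X_k, X_l] is central, differentiating the second
   system gives linear relations among the Z_m Z_k a_i that force all of them to vanish. Hence the
   Z_k a_i are constants and, as the X_k generate the tangent spaces, a and b are determined by
   a(0), (Z_k a_i)(0), b(0). For any such data with Z_k a_i and b_ij skew, an explicit polynomial
   solution exists; it is the combination of the Xhat_i, Y_ij, theta_ij with these coefficients. *)

theory Submission
  imports Defs
begin

text \<open>The rigidity step works because, by the second system, the bracket derivative Y_kl b_ij
  is a combination of first derivatives of the a_i. Applying Z_m to it and moving Y_kl past Z_m
  gives a second expression, in which Y_kl acts on a_i and a_j alone. The resulting relations for
  d_mki = Z_m Z_k a_i, skew in k and i, are solved by counting distinct indices: a repeated index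
  forces zero, and three distinct ones give d_kji = 2 d_jki, which applied twice reads d = 4 d. The
  other obstacle is the ordering i < j, which splits X_i, Xhat_i and theta_ij into cases by sign.
  Extending coordinates, fields and coefficients skew-symmetrically turns each into one sum over all
  indices; sums over pairs then count each pair twice and carry a factor 1/2. For the converse, the
  first-order part of the commutator must vanish too. There Z_k Z_k a_i = 0 since Z_k a_i is
  constant, and the other terms cancel because a skew matrix contracted with Z_k Z_i leaves half of
  [Z_k, Z_i].\<close>

subsection \<open>Smooth functions\<close>

definition dd :: "'a::real_normed_vector \<Rightarrow> ('a \<Rightarrow> real) \<Rightarrow> 'a \<Rightarrow> real" where
  "dd v f p = frechet_derivative f (at p) v"

lemma Ck_Suc_dd: "Ck (Suc k) f \<longleftrightarrow> (\<forall>p. f differentiable at p) \<and> (\<forall>v. Ck k (dd v f))"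
  by (simp add: dd_def[abs_def])

declare Ck.simps(2) [simp del]

lemma dd_eqI: "(f has_derivative f') (at p) \<Longrightarrow> dd v f p = f' v"
  unfolding dd_def using frechet_derivative_at by metis

lemma has_derivative_dd: "f differentiable at p \<Longrightarrow> (f has_derivative (\<lambda>v. dd v f p)) (at p)"
  unfolding dd_def using frechet_derivative_works by blast

lemma dd_const [simp]: "dd v (\<lambda>_. c) = (\<lambda>_. 0)"
  by (simp add: dd_def fun_eq_iff)

lemma dd_add:
  assumes "f differentiable at p" "g differentiable at p"
  shows "dd v (\<lambda>p. f p + g p) p = dd v f p + dd v g p"
  by (rule dd_eqI) (intro has_derivative_add has_derivative_dd assms)

lemma dd_mult:
  assumes "f differentiable at p" "g differentiable at p"
  shows "dd v (\<lambda>p. f p * g p) p = f p * dd v g p + dd v f p * g p"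
  by (rule dd_eqI) (intro has_derivative_mult has_derivative_dd assms)

lemma dd_bounded_linear: "bounded_linear f \<Longrightarrow> dd v f = (\<lambda>_. f v)"
  by (rule ext) (rule dd_eqI, rule bounded_linear_imp_has_derivative)

lemma Ck_SucD: "Ck (Suc k) f \<Longrightarrow> Ck k f"
proof (induction k arbitrary: f)
  case 0
  then show ?case
    by (simp add: Ck_Suc_dd continuous_on_eq_continuous_at differentiable_imp_continuous_within)
next
  case (Suc k)
  then show ?case
    by (metis Ck_Suc_dd)
qed

lemma Ck_const: "Ck k (\<lambda>_. c)"
  by (induction k arbitrary: c) (simp_all add: Ck_Suc_dd)

lemma Ck_bounded_linear: "bounded_linear f \<Longrightarrow> Ck k f"
  by (cases k)
     (simp_all add: Ck_Suc_dd Ck_const dd_bounded_linear linear_continuous_on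
        bounded_linear_imp_differentiable)

lemma Ck_add: "Ck k f \<Longrightarrow> Ck k g \<Longrightarrow> Ck k (\<lambda>p. f p + g p)"
proof (induction k arbitrary: f g)
  case 0
  then show ?case by (simp add: continuous_on_add)
next
  case (Suc k)
  then have "dd v (\<lambda>p. f p + g p) = (\<lambda>p. dd v f p + dd v g p)" for v
    by (auto simp: fun_eq_iff Ck_Suc_dd dd_add)
  with Suc show ?case by (simp add: Ck_Suc_dd)
qed

lemma Ck_mult: "Ck k f \<Longrightarrow> Ck k g \<Longrightarrow> Ck k (\<lambda>p. f p * g p)"
proof (induction k arbitrary: f g)
  case 0
  then show ?case by (simp add: continuous_on_mult)
next
  case (Suc k)
  then have "dd v (\<lambda>p. f p * g p) = (\<lambda>p. f p * dd v g p + dd v f p * g p)" for v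
    by (auto simp: fun_eq_iff Ck_Suc_dd dd_mult)
  moreover have "Ck k f" "Ck k g"
    using Suc.prems by (auto dest: Ck_SucD)
  ultimately show ?case
    using Suc by (simp add: Ck_Suc_dd Ck_add)
qed

lemma smooth_differentiable: "smooth f \<Longrightarrow> f differentiable at p"
  unfolding smooth_def by (metis Ck_Suc_dd)

lemma smooth_dd: "smooth f \<Longrightarrow> smooth (dd v f)"
  unfolding smooth_def by (metis Ck_Suc_dd)

lemma smooth_const: "smooth (\<lambda>_. c)"
  by (simp add: smooth_def Ck_const)

lemma smooth_bounded_linear: "bounded_linear f \<Longrightarrow> smooth f"
  by (simp add: smooth_def Ck_bounded_linear)

lemma smooth_add: "smooth f \<Longrightarrow> smooth g \<Longrightarrow> smooth (\<lambda>p. f p + g p)"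
  by (simp add: smooth_def Ck_add)

lemma smooth_mult: "smooth f \<Longrightarrow> smooth g \<Longrightarrow> smooth (\<lambda>p. f p * g p)"
  by (simp add: smooth_def Ck_mult)

lemma smooth_minus: "smooth f \<Longrightarrow> smooth (\<lambda>p. - f p)"
  using smooth_mult[OF smooth_const[of "-1"]] by fastforce

lemma smooth_diff: "smooth f \<Longrightarrow> smooth g \<Longrightarrow> smooth (\<lambda>p. f p - g p)"
  using smooth_add[OF _ smooth_minus] by fastforce

lemma smooth_sum: "(\<And>i. i \<in> S \<Longrightarrow> smooth (f i)) \<Longrightarrow> smooth (\<lambda>p. \<Sum>i\<in>S. f i p)"
  by (induction S rule: infinite_finite_induct) (simp_all add: smooth_const smooth_add)

lemma smooth_divide: "smooth f \<Longrightarrow> smooth (\<lambda>p. f p / c)"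
  unfolding divide_inverse by (intro smooth_mult smooth_const)

lemmas smooth_intros = smooth_const smooth_add smooth_mult smooth_divide smooth_minus smooth_diff
  smooth_sum smooth_dd

section \<open>Symmetry of mixed second derivatives\<close>

lemma dd_line:
  assumes "f differentiable at (p + t *\<^sub>R v)"
  shows "((\<lambda>t. f (p + t *\<^sub>R v)) has_field_derivative dd v f (p + t *\<^sub>R v)) (at t)"
proof -
  have "((\<lambda>t. p + t *\<^sub>R v) has_derivative (\<lambda>s. s *\<^sub>R v)) (at t)"
    by (auto intro!: derivative_eq_intros)
  from diff_chain_at[OF this has_derivative_dd[OF assms]]
  have "((\<lambda>t. f (p + t *\<^sub>R v)) has_derivative (\<lambda>s. dd (s *\<^sub>R v) f (p + t *\<^sub>R v))) (at t)"
    by (simp add: o_def)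
  moreover have "dd (s *\<^sub>R v) f (p + t *\<^sub>R v) = dd v f (p + t *\<^sub>R v) * s" for s
    using linear_scale[OF linear_frechet_derivative[OF assms]] by (simp add: dd_def)
  ultimately show ?thesis
    by (simp add: has_field_derivative_def)
qed

text \<open>The mean value theorem is used once in direction \<open>u\<close>, on the increment of
  \<open>f\<close> along h v, and once in direction \<open>v\<close>. The left side is symmetric in
  \<open>u\<close> and \<open>v\<close>, so the same number also represents the other mixed
  derivative.\<close>

lemma second_difference:
  assumes f: "smooth f" and "0 < h"
  obtains s t where "0 < s" "s < h" "0 < t" "t < h"
    "f (p + h *\<^sub>R u + h *\<^sub>R v) - f (p + h *\<^sub>R u) - (f (p + h *\<^sub>R v) - f p)
      = h * h * dd v (dd u f) (p + s *\<^sub>R u + t *\<^sub>R v)"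
proof -
  have "((\<lambda>s. f (p + s *\<^sub>R u + h *\<^sub>R v) - f (p + s *\<^sub>R u)) has_field_derivative
      dd u f (p + s *\<^sub>R u + h *\<^sub>R v) - dd u f (p + s *\<^sub>R u)) (at s)" for s
    using dd_line[OF smooth_differentiable[OF f], where p = "p + h *\<^sub>R v" and t = s and v = u]
      dd_line[OF smooth_differentiable[OF f], where p = p and t = s and v = u]
    by (auto intro!: DERIV_diff simp: ac_simps)
  from MVT2[OF \<open>0 < h\<close>, OF this] obtain s where s: "0 < s" "s < h"
    "f (p + h *\<^sub>R u + h *\<^sub>R v) - f (p + h *\<^sub>R u) - (f (p + h *\<^sub>R v) - f p)
      = h * (dd u f (p + s *\<^sub>R u + h *\<^sub>R v) - dd u f (p + s *\<^sub>R u))"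
    by auto
  have "((\<lambda>t. dd u f (p + s *\<^sub>R u + t *\<^sub>R v)) has_field_derivative
      dd v (dd u f) (p + s *\<^sub>R u + t *\<^sub>R v)) (at t)" for t
    by (intro dd_line smooth_differentiable smooth_dd f)
  from MVT2[OF \<open>0 < h\<close>, OF this]
  obtain t where "0 < t" "t < h"
    "dd u f (p + s *\<^sub>R u + h *\<^sub>R v) - dd u f (p + s *\<^sub>R u) = h * dd v (dd u f) (p + s *\<^sub>R u + t *\<^sub>R v)"
    by auto
  with s that show ?thesis by simp
qed

lemma smooth_isCont: "smooth f \<Longrightarrow> isCont f p"
  by (simp add: differentiable_imp_continuous_within smooth_differentiable)

text \<open>Reading the second difference in both orders yields points \<open>q\<close> and
  \<open>r\<close> within h * \<open>K\<close> of \<open>p\<close> where the two mixed derivatives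
  agree. Both are continuous by smoothness, and h tends to 0.\<close>

lemma dd_commute:
  assumes f: "smooth f"
  shows "dd u (dd v f) p = dd v (dd u f) p"
proof -
  define K where "K = norm u + norm v"
  have near: "norm (p + s *\<^sub>R x + t *\<^sub>R y - p) \<le> h * (norm x + norm y)"
    if "0 < s" "s < h" "0 < t" "t < h" for h s t x y
    using norm_triangle_ineq[of "s *\<^sub>R x" "t *\<^sub>R y"] that
      mult_right_mono[of s h "norm x"] mult_right_mono[of t h "norm y"]
    by (simp add: distrib_left add.assoc)
  have "\<exists>q r. norm (q - p) \<le> h * K \<and> norm (r - p) \<le> h * K \<and> dd v (dd u f) q = dd u (dd v f) r"
    if h: "0 < h" for h
  proof -
    obtain s t where 1: "0 < s" "s < h" "0 < t" "t < h"
      "f (p + h *\<^sub>R u + h *\<^sub>R v) - f (p + h *\<^sub>R u) - (f (p + h *\<^sub>R v) - f p)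
        = h * h * dd v (dd u f) (p + s *\<^sub>R u + t *\<^sub>R v)"
      using second_difference[OF f h] .
    obtain s' t' where 2: "0 < s'" "s' < h" "0 < t'" "t' < h"
      "f (p + h *\<^sub>R v + h *\<^sub>R u) - f (p + h *\<^sub>R v) - (f (p + h *\<^sub>R u) - f p)
        = h * h * dd u (dd v f) (p + s' *\<^sub>R v + t' *\<^sub>R u)"
      using second_difference[OF f h] .
    have "h * h * dd v (dd u f) (p + s *\<^sub>R u + t *\<^sub>R v) = h * h * dd u (dd v f) (p + s' *\<^sub>R v + t' *\<^sub>R u)"
      unfolding 1(5)[symmetric] 2(5)[symmetric] by (simp add: algebra_simps)
    with h have "dd v (dd u f) (p + s *\<^sub>R u + t *\<^sub>R v) = dd u (dd v f) (p + s' *\<^sub>R v + t' *\<^sub>R u)"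
      by simp
    moreover have "norm (p + s *\<^sub>R u + t *\<^sub>R v - p) \<le> h * K"
      "norm (p + s' *\<^sub>R v + t' *\<^sub>R u - p) \<le> h * K"
      using near[OF 1(1-4), of u v] near[OF 2(1-4), of v u]
      unfolding K_def add.commute[of "norm v"] by simp_all
    ultimately show ?thesis by blast
  qed
  then have "\<forall>n. \<exists>q r. norm (q - p) \<le> inverse (real (Suc n)) * K \<and>
      norm (r - p) \<le> inverse (real (Suc n)) * K \<and> dd v (dd u f) q = dd u (dd v f) r"
    by simp
  then obtain q r where
    q: "\<And>n. norm (q n - p) \<le> inverse (real (Suc n)) * K" and
    r: "\<And>n. norm (r n - p) \<le> inverse (real (Suc n)) * K" and
    eq: "\<And>n. dd v (dd u f) (q n) = dd u (dd v f) (r n)"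
    by metis
  have lim: "z \<longlonglongrightarrow> p" if "\<And>n. norm (z n - p) \<le> inverse (real (Suc n)) * K" for z
    unfolding LIM_zero_iff[of z p, symmetric]
    by (rule Lim_null_comparison[OF always_eventually
          tendsto_mult_left_zero[OF LIMSEQ_inverse_real_of_nat, of K]]) (use that in blast)
  have "(\<lambda>n. dd v (dd u f) (q n)) \<longlonglongrightarrow> dd v (dd u f) p"
    by (rule isCont_tendsto_compose[OF smooth_isCont[OF smooth_dd[OF smooth_dd[OF f]]] lim[OF q]])
  moreover have "(\<lambda>n. dd u (dd v f) (r n)) \<longlonglongrightarrow> dd u (dd v f) p"
    by (rule isCont_tendsto_compose[OF smooth_isCont[OF smooth_dd[OF smooth_dd[OF f]]] lim[OF r]])
  ultimately show ?thesis
    by (simp add: eq LIMSEQ_unique)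
qed

subsection \<open>Skew-symmetric indexing\<close>

text \<open>Only entries above the diagonal are read. One definition serves real coefficients, the
  coordinates \<open>yc p\<close> and the fields \<open>dy\<close>, whose values outside i < j carry
  no meaning.\<close>

definition skew :: "('n::linorder \<Rightarrow> 'n \<Rightarrow> 'v::group_add) \<Rightarrow> 'n \<Rightarrow> 'n \<Rightarrow> 'v" where
  "skew b i j = (if i < j then b i j else if j < i then - b j i else 0)"

lemma skew_commute: "skew b j i = - skew b i j"
  by (auto simp: skew_def)

lemma skew_same [simp]: "skew b i i = 0"
  by (simp add: skew_def)

lemma skew_less: "i < j \<Longrightarrow> skew b i j = b i j"
  by (simp add: skew_def)

lemma skew_greater: "j < i \<Longrightarrow> skew b i j = - b j i"
  by (auto simp: skew_def)

lemma sum_split_at: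
  fixes f :: "'n::{finite, linorder} \<Rightarrow> 'v::comm_monoid_add"
  shows "(\<Sum>l\<in>UNIV. f l) = (\<Sum>l\<in>{..<k}. f l) + f k + (\<Sum>l\<in>{k<..}. f l)"
proof -
  have "UNIV = insert k ({..<k} \<union> {k<..})" by auto
  moreover have "(\<Sum>l\<in>insert k ({..<k} \<union> {k<..}). f l) = f k + ((\<Sum>l\<in>{..<k}. f l) + (\<Sum>l\<in>{k<..}. f l))"
    by (subst sum.insert; (subst sum.union_disjoint)?) auto
  ultimately show ?thesis by (simp add: ac_simps)
qed

text \<open>Exchanging i and j changes the sign of both factors, so each pair i < j is met twice
  with the same product.\<close>

lemma sum_less_pairs_skew:
  fixes b :: "'n::{finite, linorder} \<Rightarrow> 'n \<Rightarrow> real" and v :: "'n \<Rightarrow> 'n \<Rightarrow> 'v::real_vector"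
  shows "(\<Sum>(i, j)\<in>{(i, j). i < j}. b i j *\<^sub>R v i j) = (1/2) *\<^sub>R (\<Sum>i\<in>UNIV. \<Sum>j\<in>UNIV. skew b i j *\<^sub>R skew v i j)"
proof -
  define g where "g i j = (if i < j then b i j *\<^sub>R v i j else 0)" for i j
  have "(\<Sum>(i, j)\<in>{(i, j). i < j}. b i j *\<^sub>R v i j) = (\<Sum>(i, j)\<in>UNIV. g i j)"
    by (rule sum.mono_neutral_cong_left) (auto simp: g_def split: if_splits)
  also have "\<dots> = (\<Sum>i\<in>UNIV. \<Sum>j\<in>UNIV. g i j)"
    by (simp add: sum.cartesian_product)
  finally have eq: "(\<Sum>(i, j)\<in>{(i, j). i < j}. b i j *\<^sub>R v i j) = (\<Sum>i\<in>UNIV. \<Sum>j\<in>UNIV. g i j)" .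
  have "(\<Sum>i\<in>UNIV. \<Sum>j\<in>UNIV. skew b i j *\<^sub>R skew v i j)
      = (\<Sum>i\<in>UNIV. \<Sum>j\<in>UNIV. g i j) + (\<Sum>i\<in>UNIV. \<Sum>j\<in>UNIV. g j i)"
    unfolding sum.distrib[symmetric] by (intro sum.cong) (auto simp: g_def skew_def)
  also have "(\<Sum>i\<in>UNIV. \<Sum>j\<in>UNIV. g j i) = (\<Sum>i\<in>UNIV. \<Sum>j\<in>UNIV. g i j)"
    by (rule sum.swap)
  finally show ?thesis
    by (simp add: eq scaleR_2[symmetric])
qed

definition \<delta> :: "'a \<Rightarrow> 'a \<Rightarrow> real" where
  "\<delta> i j = (if i = j then 1 else 0)"

lemma \<delta>_same [simp]: "\<delta> i i = 1"
  and \<delta>_neq [simp]: "i \<noteq> j \<Longrightarrow> \<delta> i j = 0"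
  by (simp_all add: \<delta>_def)

lemma sum_\<delta> [simp]:
  fixes f :: "'n::finite \<Rightarrow> real"
  shows "(\<Sum>k\<in>UNIV. \<delta> k i * f k) = f i" "(\<Sum>k\<in>UNIV. \<delta> i k * f k) = f i"
    "(\<Sum>k\<in>UNIV. f k * \<delta> k i) = f i" "(\<Sum>k\<in>UNIV. f k * \<delta> i k) = f i"
  by (simp_all add: \<delta>_def if_distrib[where f = "\<lambda>x. x * _"] if_distrib[where f = "\<lambda>x. _ * x"]
        cong: if_cong)

subsection \<open>The frame in skew-symmetric coordinates\<close>

lemma bounded_linear_xc: "bounded_linear (\<lambda>p. xc p i)"
  unfolding xc_def
  by (rule bounded_linear_compose[OF bounded_linear_vec_nth bounded_linear_fst])

lemma bounded_linear_yc: "bounded_linear (\<lambda>p. yc p i j)"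
  unfolding yc_def
  by (rule bounded_linear_compose[OF bounded_linear_vec_nth bounded_linear_snd])

lemma bounded_linear_ysk: "bounded_linear (\<lambda>p. skew (yc p) i j)"
  by (cases i j rule: linorder_cases)
     (simp_all add: skew_less skew_greater bounded_linear_yc bounded_linear_minus bounded_linear_zero)

lemmas xc_linear = bounded_linear.linear[OF bounded_linear_xc]
lemmas ysk_linear = bounded_linear.linear[OF bounded_linear_ysk]

lemma Abs_ypair_eq_iff: "i < j \<Longrightarrow> k < l \<Longrightarrow> Abs_ypair (i, j) = Abs_ypair (k, l) \<longleftrightarrow> i = k \<and> j = l"
  by (subst Abs_ypair_inject) auto

lemma xc_dx: "xc (dx k) i = \<delta> k i"
  by (auto simp: xc_def dx_def axis_def)

lemma xc_dy: "xc (skew dy k l) i = 0"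
  by (auto simp: xc_def skew_def dy_def)

lemma ysk_dx: "skew (yc (dx k)) i j = 0"
  by (auto simp: skew_def yc_def dx_def)

lemma ysk_dy: "skew (yc (skew dy k l)) i j = \<delta> k i * \<delta> l j - \<delta> k j * \<delta> l i"
  by (cases i j rule: linorder_cases; cases k l rule: linorder_cases)
     (auto simp: skew_def yc_def dy_def axis_def Abs_ypair_eq_iff \<delta>_def)

lemma nil_eqI:
  assumes "\<And>i. xc p i = xc q i" and y: "\<And>i j. i < j \<Longrightarrow> skew (yc p) i j = skew (yc q) i j"
  shows "p = q"
proof (rule prod_eqI)
  show "fst p = fst q"
    using assms by (simp add: xc_def vec_eq_iff)
  have "snd p $ Abs_ypair (i, j) = snd q $ Abs_ypair (i, j)" if "i < j" for i j
    using y[OF that] that by (simp add: skew_less yc_def)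
  then show "snd p = snd q"
    unfolding vec_eq_iff using Abs_ypair_cases by (metis (mono_tags, lifting) case_prodE mem_Collect_eq)
qed

lemma sum_skew_dy: "(\<Sum>l\<in>UNIV. xc p l *\<^sub>R skew dy l k)
    = (\<Sum>l\<in>{..<k}. xc p l *\<^sub>R dy l k) - (\<Sum>l\<in>{k<..}. xc p l *\<^sub>R dy k l)"
proof -
  have "(\<Sum>l\<in>{..<k}. xc p l *\<^sub>R skew dy l k) = (\<Sum>l\<in>{..<k}. xc p l *\<^sub>R dy l k)"
    by (rule sum.cong) (auto simp: skew_less)
  moreover have "(\<Sum>l\<in>{k<..}. xc p l *\<^sub>R skew dy l k) = - (\<Sum>l\<in>{k<..}. xc p l *\<^sub>R dy k l)"
    unfolding sum_negf[symmetric] by (rule sum.cong) (auto simp: skew_greater)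
  ultimately show ?thesis by (simp add: sum_split_at[where k = k])
qed

lemma X_eq: "X k p = dx k + (1/2) *\<^sub>R (\<Sum>l\<in>UNIV. xc p l *\<^sub>R skew dy l k)"
  by (simp add: X_def sum_skew_dy)

lemma Xhat_eq: "Xhat k p = dx k - (1/2) *\<^sub>R (\<Sum>l\<in>UNIV. xc p l *\<^sub>R skew dy l k)"
  by (simp add: Xhat_def sum_skew_dy)

lemmas linear_simps = linear_add linear_diff linear_scale linear_sum

lemma xc_X: "xc (X k p) i = \<delta> k i"
  by (simp add: X_eq linear_simps[OF xc_linear] xc_dx xc_dy)

lemma ysk_X: "skew (yc (X k p)) i j = (xc p i * \<delta> k j - xc p j * \<delta> k i) / 2"
  by (simp add: X_eq linear_simps[OF ysk_linear] ysk_dx ysk_dy right_diff_distrib sum_subtractf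
      mult.assoc[symmetric] sum_distrib_right[symmetric])

lemma xc_Xhat: "xc (Xhat k p) i = \<delta> k i"
  by (simp add: Xhat_eq linear_simps[OF xc_linear] xc_dx xc_dy)

lemma ysk_Xhat: "skew (yc (Xhat k p)) i j = - (xc p i * \<delta> k j - xc p j * \<delta> k i) / 2"
  by (simp add: Xhat_eq linear_simps[OF ysk_linear] ysk_dx ysk_dy right_diff_distrib sum_subtractf
      mult.assoc[symmetric] sum_distrib_right[symmetric])

subsection \<open>Commutation relations\<close>

lemma smooth_xc: "smooth (\<lambda>p. xc p i)"
  by (rule smooth_bounded_linear[OF bounded_linear_xc])

lemma smooth_ysk: "smooth (\<lambda>p. skew (yc p) i j)"
  by (rule smooth_bounded_linear[OF bounded_linear_ysk])

lemma vf_op_dd: "vf_op V f p = dd (V p) f p"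
  by (simp add: vf_op_def dd_def)

abbreviation Z :: "'n::generator_index \<Rightarrow> 'n operator" where
  "Z k \<equiv> vf_op (X k)"

abbreviation W :: "'n::generator_index \<Rightarrow> 'n \<Rightarrow> 'n operator" where
  "W i j \<equiv> dd (skew dy i j)"

lemma dd_linear: "smooth f \<Longrightarrow> linear (\<lambda>v. dd v f p)"
  unfolding dd_def by (rule linear_frechet_derivative[OF smooth_differentiable])

lemma dd_cmult: "smooth f \<Longrightarrow> dd v (\<lambda>p. c * f p) p = c * dd v f p"
  by (simp add: dd_mult smooth_differentiable)

lemma dd_divide: "smooth f \<Longrightarrow> dd v (\<lambda>p. f p / c) p = dd v f p / c"
  using dd_cmult[of f v "inverse c" p] by (simp add: divide_inverse_commute)

lemma dd_sum: "(\<And>i. i \<in> S \<Longrightarrow> smooth (f i)) \<Longrightarrow> dd v (\<lambda>p. \<Sum>i\<in>S. f i p) p = (\<Sum>i\<in>S. dd v (f i) p)"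
  by (induction S rule: infinite_finite_induct)
     (simp_all add: dd_add smooth_differentiable smooth_sum)

lemma dd_diff: "smooth f \<Longrightarrow> smooth g \<Longrightarrow> dd v (\<lambda>p. f p - g p) p = dd v f p - dd v g p"
  using dd_add[of f p "\<lambda>p. - 1 * g p" v] dd_cmult[of g v "-1" p]
    smooth_mult[OF smooth_const[of "-1"], of g]
  by (simp add: smooth_differentiable)

lemma dd_mult_smooth: "smooth f \<Longrightarrow> smooth g \<Longrightarrow> dd v (\<lambda>p. f p * g p) p = f p * dd v g p + dd v f p * g p"
  by (simp add: dd_mult smooth_differentiable)

lemma dd_add_smooth: "smooth f \<Longrightarrow> smooth g \<Longrightarrow> dd v (\<lambda>p. f p + g p) p = dd v f p + dd v g p"
  by (simp add: dd_add smooth_differentiable)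

lemma dd_xc: "dd v (\<lambda>p. xc p i) p = xc v i"
  by (simp add: dd_bounded_linear[OF bounded_linear_xc])

lemma dd_ysk: "dd v (\<lambda>p. skew (yc p) i j) p = skew (yc v) i j"
  by (simp add: dd_bounded_linear[OF bounded_linear_ysk])

lemmas dd_simps = dd_cmult dd_divide dd_mult_smooth dd_add_smooth dd_diff dd_sum dd_xc dd_ysk

lemma W_skew: "smooth f \<Longrightarrow> W j i f p = - W i j f p"
  using linear_neg[OF dd_linear] by (metis skew_commute)

lemma Z_eq: "smooth f \<Longrightarrow> Z k f = (\<lambda>p. dd (dx k) f p + 1/2 * (\<Sum>l\<in>UNIV. xc p l * W l k f p))"
  by (auto simp: vf_op_dd X_eq linear_simps[OF dd_linear])

lemma smooth_Z: "smooth f \<Longrightarrow> smooth (Z k f)"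
  by (simp add: Z_eq smooth_intros smooth_xc del: times_divide_eq_left)

text \<open>The coefficients of \<open>X k\<close> depend on x alone while \<open>W i j\<close>
  differentiates in y alone, and derivatives in constant directions commute.\<close>

lemma Z_W:
  assumes f: "smooth f"
  shows "Z k (W i j f) p = W i j (Z k f) p"
  using f by (simp add: Z_eq dd_simps smooth_intros smooth_xc xc_dy dd_commute[of f "dx k"]
     dd_commute[of f "skew dy i j" "skew dy _ _"] del: times_divide_eq_left)

text \<open>In the expansion proved below, everything except 1/2 * \<open>W k l f p\<close> is
  symmetric in \<open>k\<close> and \<open>l\<close>; that term arises when \<open>dx k\<close>
  differentiates a coefficient of \<open>X l\<close>. Skewness of \<open>W\<close> turns the
  difference of two halves into a full bracket.\<close>

lemma Z_Z:
  assumes f: "smooth f"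
  shows "Z k (Z l f) p = Z l (Z k f) p + W k l f p"
proof -
  define S where "S k l = (\<Sum>m\<in>UNIV. \<Sum>n\<in>UNIV. xc p m * (xc p n * dd (skew dy m k) (W n l f) p))" for k l
  have dd_Z: "dd v (Z l f) p = dd v (dd (dx l) f) p
      + 1/2 * (\<Sum>n\<in>UNIV. xc p n * dd v (W n l f) p + xc v n * W n l f p)" for v l
    using f by (simp add: Z_eq dd_simps smooth_intros smooth_xc del: times_divide_eq_left)
  have *: "Z k (Z l f) p = dd (dx k) (dd (dx l) f) p
      + 1/2 * (\<Sum>m\<in>UNIV. xc p m * dd (dx k) (W m l f) p)
      + 1/2 * W k l f p
      + 1/2 * (\<Sum>m\<in>UNIV. xc p m * dd (dx l) (W m k f) p) + 1/4 * S k l" for k l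
  proof -
    have "Z k (Z l f) p = dd (dx k) (Z l f) p + 1/2 * (\<Sum>m\<in>UNIV. xc p m * W m k (Z l f) p)"
      by (simp add: Z_eq[OF smooth_Z[OF f]])
    moreover have "(\<Sum>m\<in>UNIV. xc p m * W m k (Z l f) p)
        = (\<Sum>m\<in>UNIV. xc p m * dd (dx l) (W m k f) p) + 1/2 * S k l"
      by (simp add: dd_Z xc_dy S_def dd_commute[OF f, of _ "dx l"] distrib_left sum.distrib
          sum_distrib_left sum_divide_distrib)
    ultimately show ?thesis
      by (simp add: dd_Z[of "dx k"] xc_dx sum.distrib distrib_left)
  qed
  have "S k l = S l k"
    unfolding S_def by (subst sum.swap) (simp add: dd_commute[OF f, of "skew dy _ k"] ac_simps)
  then show ?thesis
    unfolding *[of k l] *[of l k] using dd_commute[OF f, of "dx k" "dx l"] W_skew[OF f, of k l p] by simp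
qed

subsection \<open>The commutator with the sub-Laplacian\<close>

lemma vf_op_mult: "smooth f \<Longrightarrow> smooth g \<Longrightarrow> vf_op V (\<lambda>p. f p * g p) p = f p * vf_op V g p + vf_op V f p * g p"
  and vf_op_add: "smooth f \<Longrightarrow> smooth g \<Longrightarrow> vf_op V (\<lambda>p. f p + g p) p = vf_op V f p + vf_op V g p"
  and vf_op_diff: "smooth f \<Longrightarrow> smooth g \<Longrightarrow> vf_op V (\<lambda>p. f p - g p) p = vf_op V f p - vf_op V g p"
  and vf_op_cmult: "smooth f \<Longrightarrow> vf_op V (\<lambda>p. c * f p) p = c * vf_op V f p"
  and vf_op_divide: "smooth f \<Longrightarrow> vf_op V (\<lambda>p. f p / c) p = vf_op V f p / c"
  and vf_op_const: "vf_op V (\<lambda>p. c) p = 0"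
  by (simp_all add: vf_op_dd dd_simps)

lemma vf_op_sum: "(\<And>i. i \<in> S \<Longrightarrow> smooth (f i)) \<Longrightarrow> vf_op V (\<lambda>p. \<Sum>i\<in>S. f i p) p = (\<Sum>i\<in>S. vf_op V (f i) p)"
  by (simp add: vf_op_dd dd_sum)

lemma Z_xc: "Z k (\<lambda>p. xc p i) p = \<delta> k i"
  by (simp add: vf_op_dd dd_xc xc_X)

lemma Z_ysk: "Z k (\<lambda>p. skew (yc p) i j) p = (xc p i * \<delta> k j - xc p j * \<delta> k i) / 2"
  by (simp add: vf_op_dd dd_ysk ysk_X)

lemmas Z_simps = vf_op_mult vf_op_add vf_op_diff vf_op_cmult vf_op_divide vf_op_const vf_op_sum Z_xc Z_ysk

text \<open>The factor 1/2 compensates for summing over ordered pairs when \<open>B\<close> is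
  skew.\<close>

definition frame_op :: "('n \<Rightarrow> 'n nil \<Rightarrow> real) \<Rightarrow> ('n \<Rightarrow> 'n \<Rightarrow> 'n nil \<Rightarrow> real) \<Rightarrow> 'n::generator_index operator"
  where "frame_op a B f p
    = (\<Sum>i\<in>UNIV. a i p * Z i f p) + 1/2 * (\<Sum>i\<in>UNIV. \<Sum>j\<in>UNIV. B i j p * W i j f p)"

definition frame_field ::
    "('n \<Rightarrow> 'n nil \<Rightarrow> real) \<Rightarrow> ('n \<Rightarrow> 'n \<Rightarrow> 'n nil \<Rightarrow> real) \<Rightarrow> 'n::generator_index vfield"
  where "frame_field a B p
    = (\<Sum>i\<in>UNIV. a i p *\<^sub>R X i p) + (1/2) *\<^sub>R (\<Sum>i\<in>UNIV. \<Sum>j\<in>UNIV. B i j p *\<^sub>R skew dy i j)"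

lemma frame_field_less_pairs:
  "(\<Sum>i\<in>UNIV. a i p *\<^sub>R X i p) + (\<Sum>(i, j)\<in>{(i, j). i < j}. b i j p *\<^sub>R Y i j p)
    = frame_field a (\<lambda>i j p. skew (\<lambda>i j. b i j p) i j) p"
  by (simp add: frame_field_def Y_def sum_less_pairs_skew)

lemma vf_op_frame_field: "smooth f \<Longrightarrow> vf_op (frame_field a B) f = frame_op a B f"
  by (auto simp: fun_eq_iff frame_field_def frame_op_def vf_op_dd linear_simps[OF dd_linear])

text \<open>Moving \<open>Z i\<close> to the left past each of the two factors \<open>Z k\<close>
  costs one bracket; as brackets are central, both costs are the same.\<close>

lemma Z_Z_Z:
  assumes f: "smooth f"
  shows "Z k (Z k (Z i f)) p = Z i (Z k (Z k f)) p + 2 * Z k (W k i f) p"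
proof -
  have "Z k (Z i f) = (\<lambda>p. Z i (Z k f) p + W k i f p)"
    by (rule ext) (rule Z_Z[OF f])
  then have "Z k (Z k (Z i f)) p = Z k (Z i (Z k f)) p + Z k (W k i f) p"
    by (simp add: vf_op_add smooth_Z smooth_dd f)
  with Z_Z[OF smooth_Z[OF f], of k i k p] Z_W[OF f, of k k i p] show ?thesis
    by simp
qed

lemma Z_Z_W: "smooth f \<Longrightarrow> Z k (Z k (W i j f)) p = W i j (Z k (Z k f)) p"
proof -
  assume f: "smooth f"
  then have "Z k (W i j f) = W i j (Z k f)"
    by (auto simp: Z_W)
  with f show ?thesis by (simp add: Z_W smooth_Z)
qed

text \<open>This is the contribution of the square of \<open>Z k\<close>, with all third derivatives
  of \<open>f\<close> already cancelled and the rest sorted by left-invariant operators.\<close>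

definition commutator_term ::
    "('n::generator_index \<Rightarrow> 'n nil \<Rightarrow> real) \<Rightarrow> ('n \<Rightarrow> 'n \<Rightarrow> 'n nil \<Rightarrow> real) \<Rightarrow> ('n nil \<Rightarrow> real) \<Rightarrow> 'n nil \<Rightarrow> 'n \<Rightarrow> real"
  where "commutator_term a B f p k =
    (\<Sum>i\<in>UNIV. Z k (Z k (a i)) p * Z i f p + 2 * Z k (a i) p * Z k (Z i f) p + 2 * a i p * Z k (W k i f) p)
    + 1/2 * (\<Sum>i\<in>UNIV. \<Sum>j\<in>UNIV. Z k (Z k (B i j)) p * W i j f p + 2 * Z k (B i j) p * Z k (W i j f) p)"

lemma commutator_frame_field:
  assumes a: "\<And>i. smooth (a i)" and B: "\<And>i j. smooth (B i j)" and f: "smooth f"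
  shows "commutator sub_laplacian (vf_op (frame_field a B)) f p
    = (\<Sum>k\<in>UNIV. commutator_term a B f p k)"
proof -
  note s = a B f smooth_Z smooth_intros
  have L: "smooth (sub_laplacian f)"
    unfolding sub_laplacian_def by (simp add: s)
  have Z1: "Z k (frame_op a B f) = (\<lambda>p. (\<Sum>i\<in>UNIV. a i p * Z k (Z i f) p + Z k (a i) p * Z i f p)
      + 1/2 * (\<Sum>i\<in>UNIV. \<Sum>j\<in>UNIV. B i j p * Z k (W i j f) p + Z k (B i j) p * W i j f p))" for k
    by (simp add: fun_eq_iff frame_op_def[abs_def] Z_simps s del: times_divide_eq_left)
  have Z2: "Z k (Z k (frame_op a B f)) p = (\<Sum>i\<in>UNIV. a i p * Z k (Z k (Z i f)) p
        + 2 * Z k (a i) p * Z k (Z i f) p + Z k (Z k (a i)) p * Z i f p)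
      + 1/2 * (\<Sum>i\<in>UNIV. \<Sum>j\<in>UNIV. B i j p * Z k (Z k (W i j f)) p
        + 2 * Z k (B i j) p * Z k (W i j f) p + Z k (Z k (B i j)) p * W i j f p)" for k
    unfolding Z1 by (simp add: Z_simps s algebra_simps del: times_divide_eq_left)
  \<comment> \<open>The terms with both derivatives on \<open>f\<close> rebuild
    \<open>frame_op\<close> applied to \<open>Z k (Z k f)\<close>, up to the bracket corrections
    \<open>2 * a i p * Z k (W k i f) p\<close> from \<open>Z_Z_Z\<close>.\<close>
  have Z3: "Z k (Z k (frame_op a B f)) p = frame_op a B (Z k (Z k f)) p + commutator_term a B f p k" for k
    unfolding Z2 frame_op_def commutator_term_def Z_Z_Z[OF f] Z_Z_W[OF f]
    by (simp add: sum.distrib algebra_simps)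
  have "frame_op a B (sub_laplacian f) p = (\<Sum>k\<in>UNIV. frame_op a B (Z k (Z k f)) p)"
  proof -
    have L': "Z i (sub_laplacian f) p = (\<Sum>k\<in>UNIV. Z i (Z k (Z k f)) p)"
      "W i j (sub_laplacian f) p = (\<Sum>k\<in>UNIV. W i j (Z k (Z k f)) p)" for i j
      unfolding sub_laplacian_def by (simp_all add: vf_op_sum dd_sum s)
    have "(\<Sum>i\<in>UNIV. \<Sum>j\<in>UNIV. \<Sum>k\<in>UNIV. B i j p * W i j (Z k (Z k f)) p)
        = (\<Sum>i\<in>UNIV. \<Sum>k\<in>UNIV. \<Sum>j\<in>UNIV. B i j p * W i j (Z k (Z k f)) p)"
      by (rule sum.cong[OF refl], rule sum.swap)
    also have "\<dots> = (\<Sum>k\<in>UNIV. \<Sum>i\<in>UNIV. \<Sum>j\<in>UNIV. B i j p * W i j (Z k (Z k f)) p)"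
      by (rule sum.swap)
    finally have swap: "(\<Sum>i\<in>UNIV. \<Sum>j\<in>UNIV. \<Sum>k\<in>UNIV. B i j p * W i j (Z k (Z k f)) p) = \<dots>" .
    have "frame_op a B (sub_laplacian f) p = (\<Sum>i\<in>UNIV. \<Sum>k\<in>UNIV. a i p * Z i (Z k (Z k f)) p)
        + 1/2 * (\<Sum>i\<in>UNIV. \<Sum>j\<in>UNIV. \<Sum>k\<in>UNIV. B i j p * W i j (Z k (Z k f)) p)"
      by (simp only: frame_op_def L' sum_distrib_left)
    also have "\<dots> = (\<Sum>k\<in>UNIV. \<Sum>i\<in>UNIV. a i p * Z i (Z k (Z k f)) p)
        + 1/2 * (\<Sum>k\<in>UNIV. \<Sum>i\<in>UNIV. \<Sum>j\<in>UNIV. B i j p * W i j (Z k (Z k f)) p)"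
      unfolding swap by (rule arg_cong2[where f = plus, OF sum.swap refl])
    also have "\<dots> = (\<Sum>k\<in>UNIV. frame_op a B (Z k (Z k f)) p)"
      by (simp only: frame_op_def sum.distrib sum_distrib_left)
    finally show ?thesis .
  qed
  then show ?thesis
    unfolding commutator_def vf_op_frame_field[OF f] vf_op_frame_field[OF L]
      sub_laplacian_def[of "frame_op a B f"] Z3 sum.distrib by simp
qed

text \<open>\<open>E3\<close> removes the first-order \<open>Z\<close> terms and \<open>E2\<close>
  cancels the \<open>Z k (W k i f)\<close> terms. Differentiating \<open>E2\<close> leaves a
  first-order term in \<open>W\<close>, which the second-order \<open>Z\<close> part cancels by
  \<open>E1\<close>.\<close>

lemma determining_equations_imp_commutes:
  assumes a: "\<And>i. smooth (a i)" and B: "\<And>i j. smooth (B i j)" and f: "smooth f"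
    and E1: "\<And>k i p. Z k (a i) p = - Z i (a k) p"
    and E2: "\<And>k i j p. Z k (B i j) p = \<delta> k j * a i p - \<delta> k i * a j p"
    and E3: "\<And>k i p. Z k (Z k (a i)) p = 0"
  shows "commutator sub_laplacian (vf_op (frame_field a B)) f p = 0"
proof -
  have ZZB: "Z k (Z k (B i j)) p = \<delta> k j * Z k (a i) p - \<delta> k i * Z k (a j) p" for k i j
  proof -
    have "Z k (B i j) = (\<lambda>p. \<delta> k j * a i p - \<delta> k i * a j p)"
      by (rule ext) (rule E2)
    then show ?thesis by (simp add: Z_simps smooth_intros a)
  qed
  \<comment> \<open>Each delta removes one summation, and skewness of \<open>w\<close> makes the two
    results equal; the 2 absorbs the 1/2 in \<open>commutator_term\<close>.\<close>
  have contract: "(\<Sum>i\<in>UNIV. \<Sum>j\<in>UNIV. (\<delta> k j * r i - \<delta> k i * r j) * w i j) = - 2 * (\<Sum>i\<in>UNIV. r i * w k i)"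
    if "\<And>i j. w j i = - w i j" for k r and w :: "'a \<Rightarrow> 'a \<Rightarrow> real"
  proof -
    have "(\<Sum>i\<in>UNIV. \<Sum>j\<in>UNIV. (\<delta> k j * r i - \<delta> k i * r j) * w i j)
        = (\<Sum>i\<in>UNIV. \<Sum>j\<in>UNIV. \<delta> k j * (r i * w i j)) - (\<Sum>i\<in>UNIV. \<delta> k i * (\<Sum>j\<in>UNIV. r j * w i j))"
      by (simp add: left_diff_distrib sum_subtractf sum_distrib_left mult.assoc)
    also have "\<dots> = (\<Sum>i\<in>UNIV. r i * w i k) - (\<Sum>j\<in>UNIV. r j * w k j)"
      by simp
    also have "(\<Sum>i\<in>UNIV. r i * w i k) = (\<Sum>i\<in>UNIV. r i * - w k i)"
      by (intro sum.cong refl arg_cong[OF that])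
    finally show ?thesis
      by (simp add: sum_negf)
  qed
  have ZW: "Z k (W j i f) p = - Z k (W i j f) p" for k i j
    unfolding Z_W[OF f] by (rule W_skew[OF smooth_Z[OF f]])
  have c: "(\<Sum>i\<in>UNIV. \<Sum>j\<in>UNIV. (\<delta> k j * Z k (a i) p - \<delta> k i * Z k (a j) p) * W i j f p)
        = - 2 * (\<Sum>i\<in>UNIV. Z k (a i) p * W k i f p)"
    "(\<Sum>i\<in>UNIV. \<Sum>j\<in>UNIV. (\<delta> k j * a i p - \<delta> k i * a j p) * Z k (W i j f) p)
        = - 2 * (\<Sum>i\<in>UNIV. a i p * Z k (W k i f) p)" for k
    by (rule contract, rule W_skew[OF f], rule contract, rule ZW)
  have T: "commutator_term a B f p k
      = 2 * (\<Sum>i\<in>UNIV. Z k (a i) p * Z k (Z i f) p) - (\<Sum>i\<in>UNIV. Z k (a i) p * W k i f p)" for k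
    unfolding commutator_term_def ZZB E2 E3 mult.assoc sum.distrib sum_distrib_left[symmetric] c
    by (simp add: field_simps)
  \<comment> \<open>Exchanging the indices and using \<open>E1\<close> shows that twice this sum is
    the sum of \<open>Z k (a i) p * W k i f p\<close>.\<close>
  have "(\<Sum>k\<in>UNIV. \<Sum>i\<in>UNIV. Z k (a i) p * Z k (Z i f) p)
      = (\<Sum>k\<in>UNIV. \<Sum>i\<in>UNIV. Z i (a k) p * Z i (Z k f) p)"
    by (rule sum.swap)
  also have "\<dots> = (\<Sum>k\<in>UNIV. \<Sum>i\<in>UNIV. Z k (a i) p * W k i f p - Z k (a i) p * Z k (Z i f) p)"
  proof (intro sum.cong refl)
    fix k i
    show "Z i (a k) p * Z i (Z k f) p = Z k (a i) p * W k i f p - Z k (a i) p * Z k (Z i f) p"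
      using Z_Z[OF f, of k i p] E1[of k i p] by (simp add: algebra_simps)
  qed
  finally show ?thesis
    by (simp add: commutator_frame_field a B f T sum_subtractf sum_distrib_left[symmetric])
qed

text \<open>The test functions \<open>u m\<close> and \<open>v i j\<close> are the coordinates translated so that \<open>p\<close> becomes
  the identity; up to second order their products isolate single coefficients at \<open>p\<close>.\<close>

lemma commutes_imp_determining_equations:
  assumes a: "\<And>i. smooth (a i)" and B: "\<And>i j. smooth (B i j)"
    and skewB: "\<And>i j p. B j i p = - B i j p"
    and comm: "\<And>f. smooth f \<Longrightarrow> commutator sub_laplacian (vf_op (frame_field a B)) f p = 0"
  shows "Z m (a n) p = - Z n (a m) p"
    and "Z m (B i j) p = \<delta> m j * a i p - \<delta> m i * a j p"
proof -
  note s = smooth_xc smooth_ysk smooth_intros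
  define u where "u m = (\<lambda>q. xc q m - xc p m)" for m
  \<comment> \<open>The bilinear correction comes from the group law: it makes
    \<open>Z k (v i j)\<close> the derivative of a y-coordinate with \<open>u\<close> in place of
    \<open>xc\<close>, hence zero at \<open>p\<close>.\<close>
  define v where "v i j = (\<lambda>q. skew (yc q) i j - skew (yc p) i j - (xc p i * xc q j - xc p j * xc q i) / 2)" for i j
  have su: "smooth (u m)" for m
    unfolding u_def by (intro s)
  have sv: "smooth (v i j)" for i j
    unfolding v_def by (intro s)
  have Zu: "Z k (u m) q = \<delta> k m" for k m q
    unfolding u_def by (simp add: Z_simps s)
  have Wu: "W i j (u m) q = 0" for i j m q
    unfolding u_def by (simp add: dd_simps s xc_dy)
  have Zv: "Z k (v i j) q = (u i q * \<delta> k j - u j q * \<delta> k i) / 2" for k i j q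
    unfolding u_def v_def
    by (simp add: Z_simps s) (simp add: algebra_simps diff_divide_distrib)
  have Wv: "W k l (v i j) q = \<delta> k i * \<delta> l j - \<delta> k j * \<delta> l i" for k l i j q
    unfolding v_def
    by (simp add: dd_simps s xc_dy ysk_dy)
  have up: "u m p = 0" and vp: "v i j p = 0" for m i j
    by (simp_all add: u_def v_def)
  have 0: "(\<Sum>k\<in>UNIV. commutator_term a B f p k) = 0" if "smooth f" for f
    using comm[OF that] commutator_frame_field[of a B f p, OF a B that] by simp
  show "Z m (a n) p = - Z n (a m) p"
  proof -
    \<comment> \<open>All \<open>W\<close> derivatives of this function vanish, and so do its
      \<open>Z\<close> derivatives at \<open>p\<close>; only the symmetrization of
      \<open>Z m (a n)\<close> survives.\<close>
    let ?f = "\<lambda>q. u m q * u n q"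
    have Zf: "Z i ?f = (\<lambda>q. \<delta> i n * u m q + \<delta> i m * u n q)" for i
      by (simp add: fun_eq_iff Z_simps su Zu)
    have ZZf: "Z k (Z i ?f) p = \<delta> k m * \<delta> i n + \<delta> i m * \<delta> k n" for k i
      unfolding Zf by (simp add: Z_simps s su Zu)
    have Wf: "W i j ?f = (\<lambda>q. 0)" for i j
      by (simp add: fun_eq_iff dd_simps su Wu)
    have "commutator_term a B ?f p k = \<delta> k m * (2 * Z k (a n) p) + \<delta> k n * (2 * Z k (a m) p)" for k
    proof -
      have "(\<Sum>i\<in>UNIV. 2 * Z k (a i) p * (\<delta> k m * \<delta> i n + \<delta> i m * \<delta> k n))
          = \<delta> k m * (\<Sum>i\<in>UNIV. 2 * Z k (a i) p * \<delta> i n) + \<delta> k n * (\<Sum>i\<in>UNIV. 2 * Z k (a i) p * \<delta> i m)"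
        unfolding sum_distrib_left sum.distrib[symmetric] by (simp add: algebra_simps)
      then show ?thesis
        unfolding commutator_term_def ZZf Wf by (simp add: Zf up vf_op_const)
    qed
    with 0[of ?f] show ?thesis
      by (simp add: smooth_mult su sum.distrib)
  qed
  show "Z m (B i j) p = \<delta> m j * a i p - \<delta> m i * a j p"
  proof -
    \<comment> \<open>At \<open>p\<close> all first derivatives and all \<open>Z k (Z l ?f)\<close>
      vanish, which isolates the coefficients of \<open>Z k (W l l' ?f)\<close>: those from
      \<open>B\<close> and the bracket corrections from \<open>a\<close>.\<close>
    let ?f = "\<lambda>q. u m q * v i j q"
    have Zf: "Z l ?f = (\<lambda>q. \<delta> l m * v i j q + (u m q * u i q * \<delta> l j - u m q * u j q * \<delta> l i) / 2)" for l
      by (simp add: fun_eq_iff Z_simps su sv Zu Zv algebra_simps)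
    have ZZf: "Z k (Z l ?f) p = 0" for k l
      unfolding Zf by (simp add: Z_simps s su sv Zu Zv up vp)
    have Wf: "W k l ?f = (\<lambda>q. (\<delta> k i * \<delta> l j - \<delta> k j * \<delta> l i) * u m q)" for k l
      by (simp add: fun_eq_iff dd_simps su sv Wu Wv)
    have ZWf: "Z k (W l l' ?f) p = (\<delta> l i * \<delta> l' j - \<delta> l j * \<delta> l' i) * \<delta> k m" for k l l'
      unfolding Wf by (simp add: Z_simps s su Zu)
    have "commutator_term a B ?f p k = 2 * \<delta> k m * (\<delta> k i * a j p - \<delta> k j * a i p)
        + \<delta> k m * (Z k (B i j) p - Z k (B j i) p)" for k
    proof -
      have "(\<Sum>l\<in>UNIV. 2 * a l p * ((\<delta> k i * \<delta> l j - \<delta> k j * \<delta> l i) * \<delta> k m))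
          = 2 * \<delta> k m * (\<delta> k i * (\<Sum>l\<in>UNIV. a l p * \<delta> l j) - \<delta> k j * (\<Sum>l\<in>UNIV. a l p * \<delta> l i))"
        unfolding sum_distrib_left sum_subtractf[symmetric] by (simp add: algebra_simps)
      moreover have "(\<Sum>l\<in>UNIV. \<Sum>l'\<in>UNIV. 2 * Z k (B l l') p * ((\<delta> l i * \<delta> l' j - \<delta> l j * \<delta> l' i) * \<delta> k m))
          = 2 * \<delta> k m * ((\<Sum>l\<in>UNIV. \<delta> l i * (\<Sum>l'\<in>UNIV. Z k (B l l') p * \<delta> l' j))
             - (\<Sum>l\<in>UNIV. \<delta> l j * (\<Sum>l'\<in>UNIV. Z k (B l l') p * \<delta> l' i)))"
        unfolding sum_distrib_left sum_subtractf[symmetric] by (simp add: algebra_simps)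
      ultimately show ?thesis
        unfolding commutator_term_def ZZf ZWf
        by (simp add: Zf Wf up vp algebra_simps)
    qed
    then have "2 * (\<delta> m i * a j p - \<delta> m j * a i p) + (Z m (B i j) p - Z m (B j i) p) = 0"
      using 0[of ?f] by (simp add: smooth_mult su sv sum.distrib mult.assoc mult.left_commute[of 2])
    moreover have "Z m (B j i) p = - Z m (B i j) p"
    proof -
      have neg: "B j i = (\<lambda>p. -1 * B i j p)"
      proof
        fix q
        show "B j i q = -1 * B i j q"
          by (subst skewB) simp
      qed
      show ?thesis
        unfolding neg vf_op_cmult[OF B] by simp
    qed
    ultimately show ?thesis by simp
  qed
qed

subsection \<open>Rigidity of the determining equations\<close>

lemma ysk_sum_dy:
  fixes b :: "'n::generator_index \<Rightarrow> 'n \<Rightarrow> real"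
  assumes "\<And>i j. b j i = - b i j"
  shows "skew (yc ((1/2) *\<^sub>R (\<Sum>k\<in>UNIV. \<Sum>l\<in>UNIV. b k l *\<^sub>R skew dy k l))) i j = b i j"
proof -
  have "(\<Sum>k\<in>UNIV. \<Sum>l\<in>UNIV. b k l * (\<delta> k i * \<delta> l j - \<delta> k j * \<delta> l i))
      = (\<Sum>k\<in>UNIV. \<delta> k i * (\<Sum>l\<in>UNIV. b k l * \<delta> l j)) - (\<Sum>k\<in>UNIV. \<delta> k j * (\<Sum>l\<in>UNIV. b k l * \<delta> l i))"
    unfolding sum_distrib_left sum_subtractf[symmetric] by (simp add: algebra_simps)
  also have "\<dots> = 2 * b i j"
    using assms[of j i] by simp
  finally show ?thesis
    by (simp add: linear_simps[OF ysk_linear] ysk_dy)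
qed

lemma xc_sum_dy: "xc ((1/2) *\<^sub>R (\<Sum>k\<in>UNIV. \<Sum>l\<in>UNIV. b k l *\<^sub>R skew dy k l)) i = 0"
  by (simp add: linear_simps[OF xc_linear] xc_dy)

lemma nil_expand:
  "v = (\<Sum>i\<in>UNIV. xc v i *\<^sub>R dx i) + (1/2) *\<^sub>R (\<Sum>i\<in>UNIV. \<Sum>j\<in>UNIV. skew (yc v) i j *\<^sub>R skew dy i j)"
  by (rule nil_eqI)
     (simp_all only: linear_add[OF xc_linear] linear_add[OF ysk_linear] xc_sum_dy ysk_sum_dy[OF skew_commute],
      simp_all add: linear_simps[OF xc_linear] linear_simps[OF ysk_linear] xc_dx ysk_dx)

lemma xc_frame_field: "xc (frame_field a B p) i = a i p"
  unfolding frame_field_def linear_add[OF xc_linear] xc_sum_dy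
  by (simp add: linear_simps[OF xc_linear] xc_X)

lemma ysk_frame_field:
  assumes "\<And>i j. B j i p = - B i j p"
  shows "skew (yc (frame_field a B p)) i j = (xc p i * a j p - xc p j * a i p) / 2 + B i j p"
proof -
  have "(\<Sum>k\<in>UNIV. a k p * ((xc p i * \<delta> k j - xc p j * \<delta> k i) / 2))
      = (xc p i * (\<Sum>k\<in>UNIV. a k p * \<delta> k j) - xc p j * (\<Sum>k\<in>UNIV. a k p * \<delta> k i)) / 2"
    unfolding sum_distrib_left sum_subtractf[symmetric] sum_divide_distrib by (simp add: algebra_simps)
  then show ?thesis
    unfolding frame_field_def linear_add[OF ysk_linear] ysk_sum_dy[of "\<lambda>i j. B i j p", OF assms]
    by (simp add: linear_simps[OF ysk_linear] ysk_X)
qed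

text \<open>Brackets of the \<open>Z k\<close> give every \<open>W k l\<close>, and subtracting
  these from \<open>X k\<close> recovers \<open>dx k\<close>; so the whole derivative
  vanishes.\<close>

lemma Z_zero_imp_const:
  assumes g: "smooth g" and Z: "\<And>k p. Z k g p = 0"
  shows "g p = g q"
proof -
  have Zg: "Z k g = (\<lambda>_. 0)" for k
    using Z by auto
  have W: "W k l g p = 0" for k l p
    using Z_Z[OF g, of k l p] by (simp add: Zg vf_op_const)
  have D: "dd (dx k) g p = 0" for k p
    using fun_cong[OF Z_eq[OF g, of k], of p] by (simp add: Zg W)
  have "dd v g p = 0" for v p
    by (subst nil_expand[of v]) (simp add: linear_simps[OF dd_linear[OF g]] D W)
  then have "(g has_derivative (\<lambda>_. 0)) (at p)" for p
    using has_derivative_dd[OF smooth_differentiable[OF g], of p] by simp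
  then obtain c where "\<forall>x\<in>UNIV. g x = c"
    using has_derivative_zero_constant[OF convex_UNIV] by blast
  then show ?thesis
    by (metis UNIV_I)
qed

lemma determining_equations_rigid:
  assumes a: "\<And>i. smooth (a i)" and B: "\<And>i j. smooth (B i j)"
    and E1: "\<And>k i p. Z k (a i) p = - Z i (a k) p"
    and E2: "\<And>k i j p. Z k (B i j) p = \<delta> k j * a i p - \<delta> k i * a j p"
  shows "Z m (Z k (a i)) p = 0"
proof -
  define d where "d m k i = Z m (Z k (a i)) p" for m k i
  define w where "w k l i = W k l (a i) p" for k l i
  note s = a B smooth_Z smooth_intros
  have d_skew: "d m i k = - d m k i" for m k i
  proof -
    have neg: "Z i (a k) = (\<lambda>p. - 1 * Z k (a i) p)"
      using E1[of k i] by (simp add: fun_eq_iff)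
    show ?thesis
      unfolding d_def neg vf_op_cmult[OF smooth_Z[OF a]] by simp
  qed
  have w: "w k l i = d k l i - d l k i" for k l i
    using Z_Z[OF a, of k l i p] by (simp add: d_def w_def)
  have ZB: "Z l (B i j) = (\<lambda>p. \<delta> l j * a i p - \<delta> l i * a j p)" for l i j
    by (rule ext) (rule E2)
  \<comment> \<open>Writing \<open>W k l\<close> as a bracket and inserting \<open>E2\<close> trades
    this derivative of \<open>B\<close> for first derivatives of \<open>a\<close>.\<close>
  have WB: "W k l (B i j) = (\<lambda>p. \<delta> l j * Z k (a i) p - \<delta> l i * Z k (a j) p
      - (\<delta> k j * Z l (a i) p - \<delta> k i * Z l (a j) p))" for k l i j
  proof
    fix p
    have "W k l (B i j) p = Z k (Z l (B i j)) p - Z l (Z k (B i j)) p"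
      using Z_Z[OF B, of k l i j p] by simp
    then show "W k l (B i j) p = \<delta> l j * Z k (a i) p - \<delta> l i * Z k (a j) p
      - (\<delta> k j * Z l (a i) p - \<delta> k i * Z l (a j) p)"
      unfolding ZB by (simp add: Z_simps s)
  qed
  \<comment> \<open>Centrality of \<open>W k l\<close> gives two evaluations of one third derivative
    of \<open>B i j\<close>; all relations used below are instances of this one.\<close>
  have *: "\<delta> m j * w k l i - \<delta> m i * w k l j
      = \<delta> l j * d m k i - \<delta> l i * d m k j - (\<delta> k j * d m l i - \<delta> k i * d m l j)" for m k l i j
  proof -
    have "Z m (W k l (B i j)) p = W k l (Z m (B i j)) p"
      by (rule Z_W[OF B])
    then show ?thesis
      unfolding ZB unfolding WB by (simp add: Z_simps dd_simps s d_def w_def)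
  qed
  have same: "d m k k = 0" for m k
    using d_skew[of m k k] by simp
  have pair: "d i j i = 0" for i j
    using *[of j j i j i] w[of i j i] same by (cases "i = j") simp_all
  \<comment> \<open>The instance reduces to \<open>w k j i = d j k i\<close>, while
    \<open>w k j i\<close> is also \<open>d k j i - d j k i\<close>.\<close>
  have triple: "d k j i = 2 * d j k i" if "i \<noteq> j" "i \<noteq> k" "j \<noteq> k" for i j k
    using *[of j j k j i] w[of k j i] that by simp
  consider "k = i" | "m = i" | "m = k" | "k \<noteq> i" "m \<noteq> i" "m \<noteq> k" by blast
  then have "d m k i = 0"
  proof cases
    case 3
    then show ?thesis using pair[of k i] d_skew[of k k i] by simp
  next
    case 4
    then have "d m k i = 2 * d k m i" "d k m i = 2 * d m k i"
      by (auto intro!: triple)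
    then show ?thesis by linarith
  qed (simp_all add: same pair)
  then show "Z m (Z k (a i)) p = 0"
    by (simp add: d_def)
qed

subsection \<open>The solutions of the determining equations\<close>

text \<open>For skew \<open>\<beta>\<close> and \<open>A\<close>, these are the coefficients of
  \<open>\<Sum> \<alpha>\<^sub>i Xhat\<^sub>i + \<Sum> \<beta>\<^sub>i\<^sub>j Y\<^sub>i\<^sub>j + \<Sum> A\<^sub>i\<^sub>j \<theta>\<^sub>i\<^sub>j\<close> in the frame \<open>X\<close>, \<open>Y\<close>.\<close>

definition sol_a :: "('n \<Rightarrow> real) \<Rightarrow> ('n \<Rightarrow> 'n \<Rightarrow> real) \<Rightarrow> 'n::generator_index \<Rightarrow> 'n nil \<Rightarrow> real" where
  "sol_a \<alpha> A i p = \<alpha> i + (\<Sum>l\<in>UNIV. A i l * xc p l)"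

definition sol_B :: "('n \<Rightarrow> real) \<Rightarrow> ('n \<Rightarrow> 'n \<Rightarrow> real) \<Rightarrow> ('n \<Rightarrow> 'n \<Rightarrow> real)
    \<Rightarrow> 'n::generator_index \<Rightarrow> 'n \<Rightarrow> 'n nil \<Rightarrow> real" where
  "sol_B \<alpha> \<beta> A i j p = \<beta> i j - (xc p i * \<alpha> j - xc p j * \<alpha> i)
    + (\<Sum>l\<in>UNIV. A i l * skew (yc p) l j + A j l * skew (yc p) i l)
    - (xc p i * (\<Sum>l\<in>UNIV. A j l * xc p l) - xc p j * (\<Sum>l\<in>UNIV. A i l * xc p l)) / 2"

lemma smooth_sol_a: "smooth (sol_a \<alpha> A i)"
  unfolding sol_a_def[abs_def] by (intro smooth_intros smooth_xc)

lemma smooth_sol_B: "smooth (sol_B \<alpha> \<beta> A i j)"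
  unfolding sol_B_def[abs_def] by (intro smooth_intros smooth_xc smooth_ysk)

lemma Z_sol_a: "Z k (sol_a \<alpha> A i) p = A i k"
  unfolding sol_a_def[abs_def] by (simp add: Z_simps smooth_intros smooth_xc)

text \<open>Differentiating the y-terms and the quadratic x-terms each yields half of the required
  linear part \<open>S\<close>; their remaining contributions, with \<open>A i k\<close> and
  \<open>A j k\<close>, cancel.\<close>

lemma Z_sol_B: "Z k (sol_B \<alpha> \<beta> A i j) p = \<delta> k j * sol_a \<alpha> A i p - \<delta> k i * sol_a \<alpha> A j p"
proof -
  define x where "x = xc p"
  define S where "S i = (\<Sum>l\<in>UNIV. A i l * x l)" for i
  have S: "(\<Sum>l\<in>UNIV. A i l * ((x l * \<delta> k j - x j * \<delta> k l) / 2) + A j l * ((x i * \<delta> k l - x l * \<delta> k i) / 2))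
      = (S i * \<delta> k j - x j * A i k + (x i * A j k - S j * \<delta> k i)) / 2"
  proof -
    have "(\<Sum>l\<in>UNIV. A i l * ((x l * \<delta> k j - x j * \<delta> k l) / 2) + A j l * ((x i * \<delta> k l - x l * \<delta> k i) / 2))
      = (S i * \<delta> k j - x j * (\<Sum>l\<in>UNIV. A i l * \<delta> k l) + (x i * (\<Sum>l\<in>UNIV. A j l * \<delta> k l) - S j * \<delta> k i)) / 2"
      unfolding S_def sum_distrib_left sum_distrib_right sum_subtractf[symmetric] sum.distrib[symmetric]
        sum_divide_distrib
      by (intro sum.cong refl) (simp add: field_simps)
    then show ?thesis by simp
  qed
  have "Z k (sol_B \<alpha> \<beta> A i j) p = - (\<delta> k i * \<alpha> j - \<delta> k j * \<alpha> i)
     + (\<Sum>l\<in>UNIV. A i l * ((x l * \<delta> k j - x j * \<delta> k l) / 2) + A j l * ((x i * \<delta> k l - x l * \<delta> k i) / 2))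
     - (x i * A j k + \<delta> k i * S j - (x j * A i k + \<delta> k j * S i)) / 2"
    unfolding sol_B_def[abs_def] by (simp add: Z_simps smooth_intros smooth_xc smooth_ysk x_def S_def)
  then show ?thesis
    unfolding S sol_a_def x_def[symmetric] S_def[symmetric]
    by (simp add: algebra_simps add_divide_distrib diff_divide_distrib)
qed

lemma sol_B_skew: "(\<And>i j. \<beta> j i = - \<beta> i j) \<Longrightarrow> sol_B \<alpha> \<beta> A j i p = - sol_B \<alpha> \<beta> A i j p"
proof -
  assume "\<And>i j. \<beta> j i = - \<beta> i j"
  then have "\<beta> j i = - \<beta> i j" .
  moreover have "(\<Sum>l\<in>UNIV. A j l * skew (yc p) l i + A i l * skew (yc p) j l)
      = - (\<Sum>l\<in>UNIV. A i l * skew (yc p) l j + A j l * skew (yc p) i l)"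
    unfolding sum_negf[symmetric]
    by (intro sum.cong refl) (simp add: skew_commute[of "yc p" _ i] skew_commute[of "yc p" j])
  ultimately show ?thesis
    unfolding sol_B_def by (simp add: field_simps)
qed

lemma sol_a_0: "sol_a \<alpha> A i 0 = \<alpha> i"
  by (simp add: sol_a_def linear_0[OF xc_linear])

lemma sol_B_0: "sol_B \<alpha> \<beta> A i j 0 = \<beta> i j"
  by (simp add: sol_B_def linear_0[OF xc_linear] linear_0[OF ysk_linear])

lemma Z_eq_imp_eq:
  assumes f: "smooth f" and g: "smooth g" and Z: "\<And>k p. Z k f p = Z k g p" and 0: "f 0 = g 0"
  shows "f = g"
proof
  fix p
  have "f p - g p = f 0 - g 0"
    using Z_zero_imp_const[of "\<lambda>p. f p - g p" p 0] by (simp add: smooth_diff f g vf_op_diff Z)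
  with 0 show "f p = g p" by simp
qed

text \<open>By rigidity \<open>Z k (a i)\<close> is the constant \<open>A i k\<close>, so
  \<open>a\<close> and \<open>sol_a\<close> share all \<open>Z\<close> derivatives and the value at
  0. \<open>B\<close> comes second because \<open>E2\<close> gives its derivatives in terms of
  \<open>a\<close>.\<close>

lemma determining_equations_solution:
  assumes a: "\<And>i. smooth (a i)" and B: "\<And>i j. smooth (B i j)"
    and E1: "\<And>k i p. Z k (a i) p = - Z i (a k) p"
    and E2: "\<And>k i j p. Z k (B i j) p = \<delta> k j * a i p - \<delta> k i * a j p"
  defines "\<alpha> \<equiv> \<lambda>i. a i 0" and "A \<equiv> \<lambda>i k. Z k (a i) 0" and "\<beta> \<equiv> \<lambda>i j. B i j 0"
  shows "a = sol_a \<alpha> A" and "B = sol_B \<alpha> \<beta> A"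
proof -
  have A: "Z k (a i) p = A i k" for k i p
    unfolding A_def
    by (rule Z_zero_imp_const[OF smooth_Z[OF a]]) (rule determining_equations_rigid[OF a B E1 E2])
  show "a = sol_a \<alpha> A"
    by (rule ext, rule Z_eq_imp_eq) (simp_all add: a smooth_sol_a A Z_sol_a sol_a_0 \<alpha>_def)
  then have "a i p = sol_a \<alpha> A i p" for i p
    by simp
  then show "B = sol_B \<alpha> \<beta> A"
    by - (rule ext, rule ext, rule Z_eq_imp_eq,
       simp_all add: B smooth_sol_B E2 Z_sol_B sol_B_0 \<beta>_def)
qed

subsection \<open>The span in the left-invariant frame\<close>

text \<open>The three ranges in the definition are the sign patterns of one skew expression, whose
  terms at k = i and k = j vanish because of diagonal entries.\<close>

lemma \<theta>_eq:
  assumes "i < j"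
  shows "\<theta> i j p = xc p j *\<^sub>R dx i - xc p i *\<^sub>R dx j
    + (\<Sum>k\<in>UNIV. skew (yc p) k j *\<^sub>R skew dy k i - skew (yc p) k i *\<^sub>R skew dy k j)"
proof -
  let ?g = "\<lambda>k. skew (yc p) k j *\<^sub>R skew dy k i - skew (yc p) k i *\<^sub>R skew dy k j"
  have split: "{i<..} = {i<..<j} \<union> insert j {j<..}"
    using assms by auto
  have "(\<Sum>k\<in>{i<..}. ?g k) = (\<Sum>k\<in>{i<..<j}. ?g k) + (\<Sum>k\<in>insert j {j<..}. ?g k)"
    unfolding split by (rule sum.union_disjoint) auto
  then have "(\<Sum>k\<in>UNIV. ?g k) = (\<Sum>k\<in>{..<i}. ?g k) + (\<Sum>k\<in>{i<..<j}. ?g k) + (\<Sum>k\<in>{j<..}. ?g k)"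
    unfolding sum_split_at[of ?g i] by simp
  moreover have "(\<Sum>k\<in>{..<i}. ?g k) = (\<Sum>k\<in>{..<i}. yc p k j *\<^sub>R dy k i - yc p k i *\<^sub>R dy k j)"
    using assms by (intro sum.cong refl) (auto simp: skew_def)
  moreover have "(\<Sum>k\<in>{i<..<j}. ?g k) = (\<Sum>k\<in>{i<..<j}. yc p i k *\<^sub>R dy k j - yc p k j *\<^sub>R dy i k)"
    using assms by (intro sum.cong refl) (auto simp: skew_less skew_greater)
  moreover have "(\<Sum>k\<in>{j<..}. ?g k) = (\<Sum>k\<in>{j<..}. yc p j k *\<^sub>R dy i k - yc p i k *\<^sub>R dy j k)"
    using assms by (intro sum.cong refl) (auto simp: skew_def)
  ultimately show ?thesis
    by (simp add: \<theta>_def)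
qed

lemma xc_\<theta>: "i < j \<Longrightarrow> xc (\<theta> i j p) m = \<delta> i m * xc p j - \<delta> j m * xc p i"
  by (simp add: \<theta>_eq linear_simps[OF xc_linear] xc_dx xc_dy)

text \<open>\<open>\<theta> i j\<close> is an infinitesimal rotation acting on y as a skew tensor:
  one pair of terms for each of the two tensor indices.\<close>

lemma ysk_\<theta>:
  assumes "i < j"
  shows "skew (yc (\<theta> i j p)) m n = \<delta> i m * skew (yc p) j n - \<delta> j m * skew (yc p) i n
    + (\<delta> i n * skew (yc p) m j - \<delta> j n * skew (yc p) m i)"
proof -
  have "(\<Sum>k\<in>UNIV. skew (yc p) k j * (\<delta> k m * \<delta> i n - \<delta> k n * \<delta> i m))
      = \<delta> i n * (\<Sum>k\<in>UNIV. skew (yc p) k j * \<delta> k m) - \<delta> i m * (\<Sum>k\<in>UNIV. skew (yc p) k j * \<delta> k n)" for i j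
    unfolding sum_distrib_left sum_subtractf[symmetric] by (simp add: algebra_simps)
  then show ?thesis
    using skew_commute[of "yc p" n] assms
    by (simp add: \<theta>_eq linear_simps[OF ysk_linear] ysk_dx ysk_dy sum_subtractf)
qed

text \<open>The bracket is the m-th entry of (E_ij - E_ji) f with matrix units E_ij, so the sum is a
  skew matrix applied to f. This serves the x-part of \<open>\<theta>\<close> and each index of its
  y-part.\<close>

lemma sum_less_pairs_\<delta>:
  fixes \<gamma> :: "'n::{finite, linorder} \<Rightarrow> 'n \<Rightarrow> real"
  shows "(\<Sum>(i, j)\<in>{(i, j). i < j}. \<gamma> i j * (\<delta> i m * f j - \<delta> j m * f i)) = (\<Sum>l\<in>UNIV. skew \<gamma> m l * f l)"
proof -
  have "skew (\<lambda>i j. \<delta> i m * f j - \<delta> j m * f i) i j = \<delta> i m * f j - \<delta> j m * f i" for i j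
    by (cases i j rule: linorder_cases) (simp_all add: skew_less skew_greater)
  then have "(\<Sum>(i, j)\<in>{(i, j). i < j}. \<gamma> i j * (\<delta> i m * f j - \<delta> j m * f i))
      = (\<Sum>i\<in>UNIV. \<Sum>j\<in>UNIV. skew \<gamma> i j * (\<delta> i m * f j - \<delta> j m * f i)) / 2"
    using sum_less_pairs_skew[of \<gamma> "\<lambda>i j. \<delta> i m * f j - \<delta> j m * f i"] by simp
  also have "(\<Sum>i\<in>UNIV. \<Sum>j\<in>UNIV. skew \<gamma> i j * (\<delta> i m * f j - \<delta> j m * f i))
      = (\<Sum>i\<in>UNIV. \<delta> i m * (\<Sum>j\<in>UNIV. skew \<gamma> i j * f j)) - (\<Sum>i\<in>UNIV. (\<Sum>j\<in>UNIV. skew \<gamma> i j * \<delta> j m) * f i)"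
    unfolding sum_distrib_left sum_distrib_right sum_subtractf[symmetric] by (simp add: algebra_simps)
  also have "\<dots> = (\<Sum>l\<in>UNIV. skew \<gamma> m l * f l) - (\<Sum>l\<in>UNIV. skew \<gamma> l m * f l)"
    by simp
  also have "(\<Sum>l\<in>UNIV. skew \<gamma> l m * f l) = - (\<Sum>l\<in>UNIV. skew \<gamma> m l * f l)"
    unfolding sum_negf[symmetric] by (intro sum.cong refl) (simp add: skew_commute[of \<gamma> _ m])
  finally show ?thesis by simp
qed

text \<open>Components in \<open>dx\<close>, \<open>dy\<close> are compared. By
  \<open>ysk_frame_field\<close> a frame field with x-part a already carries the y-part (x_i a_j -
  x_j a_i)/2, which \<open>sol_B\<close> must subtract: this doubles the term -1/2 of
  \<open>Xhat\<close> and produces the quadratic correction for \<open>\<theta>\<close>.\<close>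

lemma span_eq_frame_field:
  fixes \<alpha> :: "'n::generator_index \<Rightarrow> real"
  shows "(\<Sum>i\<in>UNIV. \<alpha> i *\<^sub>R Xhat i p) + (\<Sum>(i, j)\<in>{(i, j). i < j}. \<beta> i j *\<^sub>R Y i j p)
      + (\<Sum>(i, j)\<in>{(i, j). i < j}. \<gamma> i j *\<^sub>R \<theta> i j p)
    = frame_field (sol_a \<alpha> (skew \<gamma>)) (sol_B \<alpha> (skew \<beta>) (skew \<gamma>)) p"
    (is "?H + ?Y + ?T = _")
proof (rule nil_eqI)
  have Y: "?Y = (1/2) *\<^sub>R (\<Sum>i\<in>UNIV. \<Sum>j\<in>UNIV. skew \<beta> i j *\<^sub>R skew dy i j)"
    by (simp add: sum_less_pairs_skew Y_def)
  show "xc (?H + ?Y + ?T) m = xc (frame_field (sol_a \<alpha> (skew \<gamma>)) (sol_B \<alpha> (skew \<beta>) (skew \<gamma>)) p) m" for m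
  proof -
    have "xc ?T m = (\<Sum>(i, j)\<in>{(i, j). i < j}. \<gamma> i j * (\<delta> i m * xc p j - \<delta> j m * xc p i))"
      unfolding linear_sum[OF xc_linear]
      by (intro sum.cong refl) (auto simp: linear_scale[OF xc_linear] xc_\<theta>)
    moreover have "xc ?H m = \<alpha> m"
      by (simp add: linear_simps[OF xc_linear] xc_Xhat)
    ultimately show ?thesis
      unfolding linear_add[OF xc_linear] Y xc_sum_dy xc_frame_field sum_less_pairs_\<delta> sol_a_def by simp
  qed
  show "skew (yc (?H + ?Y + ?T)) m n
      = skew (yc (frame_field (sol_a \<alpha> (skew \<gamma>)) (sol_B \<alpha> (skew \<beta>) (skew \<gamma>)) p)) m n" for m n
  proof -
    have "skew (yc ?T) m n = (\<Sum>(i, j)\<in>{(i, j). i < j}.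
          \<gamma> i j * (\<delta> i m * skew (yc p) j n - \<delta> j m * skew (yc p) i n)
        + \<gamma> i j * (\<delta> i n * skew (yc p) m j - \<delta> j n * skew (yc p) m i))"
      unfolding linear_sum[OF ysk_linear]
      by (intro sum.cong refl) (auto simp: linear_scale[OF ysk_linear] ysk_\<theta> distrib_left)
    also have "\<dots> = (\<Sum>l\<in>UNIV. skew \<gamma> m l * skew (yc p) l n + skew \<gamma> n l * skew (yc p) m l)"
      by (simp add: case_prod_unfold sum.distrib
          sum_less_pairs_\<delta>[of \<gamma> m "\<lambda>l. skew (yc p) l n", unfolded case_prod_unfold]
          sum_less_pairs_\<delta>[of \<gamma> n "\<lambda>l. skew (yc p) m l", unfolded case_prod_unfold])
    finally have T: "skew (yc ?T) m n = \<dots>" .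
    have "(\<Sum>k\<in>UNIV. \<alpha> k * (- (xc p m * \<delta> k n - xc p n * \<delta> k m) / 2))
        = - (xc p m * (\<Sum>k\<in>UNIV. \<alpha> k * \<delta> k n) - xc p n * (\<Sum>k\<in>UNIV. \<alpha> k * \<delta> k m)) / 2"
      unfolding sum_distrib_left sum_subtractf[symmetric] sum_negf[symmetric] sum_divide_distrib
      by (intro sum.cong refl) (simp add: algebra_simps)
    then have "skew (yc ?H) m n = - (xc p m * \<alpha> n - xc p n * \<alpha> m) / 2"
      by (simp add: linear_simps[OF ysk_linear] ysk_Xhat)
    then show ?thesis
      unfolding linear_add[OF ysk_linear] T Y ysk_sum_dy[OF skew_commute]
        ysk_frame_field[of "sol_B \<alpha> (skew \<beta>) (skew \<gamma>)", OF sol_B_skew[OF skew_commute]]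
      by (simp add: sol_a_def sol_B_def field_simps)
  qed
qed

theorem proposition3p1:
  shows "(T :: 'n::generator_index vfield set) =
    {(\<lambda>p. (\<Sum>i\<in>UNIV. \<alpha> i *\<^sub>R Xhat i p)
         + (\<Sum>(i, j)\<in>{(i, j). i < j}. \<beta> i j *\<^sub>R Y i j p)
         + (\<Sum>(i, j)\<in>{(i, j). i < j}. \<gamma> i j *\<^sub>R \<theta> i j p))
     | (\<alpha> :: 'n \<Rightarrow> real) (\<beta> :: 'n \<Rightarrow> 'n \<Rightarrow> real) (\<gamma> :: 'n \<Rightarrow> 'n \<Rightarrow> real). True}"
  (is "_ = ?S")
proof
  show "T \<subseteq> ?S"
  proof
    fix V :: "'n vfield"
    assume "V \<in> T"
    then obtain a b where a: "\<And>i. smooth (a i)" and b: "\<And>i j. i < j \<Longrightarrow> smooth (b i j)"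
      and V: "V = (\<lambda>p. (\<Sum>i\<in>UNIV. a i p *\<^sub>R X i p) + (\<Sum>(i, j)\<in>{(i, j). i < j}. b i j p *\<^sub>R Y i j p))"
      and comm: "\<And>f. smooth f \<Longrightarrow> commutator sub_laplacian (vf_op V) f = (\<lambda>p. 0)"
      unfolding T_def by blast
    define B where "B i j p = skew (\<lambda>i j. b i j p) i j" for i j p
    have VF: "V = frame_field a B"
      unfolding V frame_field_less_pairs B_def[abs_def] ..
    have B: "smooth (B i j)" for i j
      by (cases i j rule: linorder_cases)
         (simp_all add: B_def[abs_def] skew_less skew_greater b smooth_minus smooth_const)
    have skewB: "B j i p = - B i j p" for i j p
      unfolding B_def by (rule skew_commute)
    have comm': "commutator sub_laplacian (vf_op (frame_field a B)) f p = 0" if "smooth f" for f p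
      using comm[OF that] by (simp add: VF)
    have E1: "Z k (a i) p = - Z i (a k) p" for k i p
      by (rule commutes_imp_determining_equations(1)[OF a B skewB comm'])
    have E2: "Z k (B i j) p = \<delta> k j * a i p - \<delta> k i * a j p" for k i j p
      by (rule commutes_imp_determining_equations(2)[OF a B skewB comm'])
    define \<alpha> A \<beta> where "\<alpha> = (\<lambda>i. a i 0)" and "A = (\<lambda>i k. Z k (a i) 0)" and "\<beta> = (\<lambda>i j. B i j 0)"
    have aB: "a = sol_a \<alpha> A" "B = sol_B \<alpha> \<beta> A"
      unfolding \<alpha>_def A_def \<beta>_def by (rule determining_equations_solution[OF a B E1 E2])+
    \<comment> \<open>The span uses only entries with i < j; skewness of \<open>A\<close> (from
      \<open>E1\<close> at 0) and of \<open>\<beta>\<close> ensures that these determine the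
      rest.\<close>
    have "skew A i k = A i k" for i k
      using E1[of k i 0] by (cases i k rule: linorder_cases) (simp_all add: A_def skew_less skew_greater)
    moreover have "skew \<beta> i j = \<beta> i j" for i j
      using skewB[of i j 0] by (cases i j rule: linorder_cases) (simp_all add: \<beta>_def skew_less skew_greater)
    ultimately have "skew A = A" "skew \<beta> = \<beta>"
      by (simp_all add: fun_eq_iff)
    then have "V = frame_field (sol_a \<alpha> (skew A)) (sol_B \<alpha> (skew \<beta>) (skew A))"
      unfolding VF using aB by simp
    then have "V = (\<lambda>p. (\<Sum>i\<in>UNIV. \<alpha> i *\<^sub>R Xhat i p)
         + (\<Sum>(i, j)\<in>{(i, j). i < j}. \<beta> i j *\<^sub>R Y i j p)
         + (\<Sum>(i, j)\<in>{(i, j). i < j}. A i j *\<^sub>R \<theta> i j p))"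
      by (simp add: fun_eq_iff span_eq_frame_field)
    then show "V \<in> ?S" by blast
  qed
  show "?S \<subseteq> T"
  proof
    fix V :: "'n vfield"
    assume "V \<in> ?S"
    then obtain \<alpha> \<beta> \<gamma> where V: "V = (\<lambda>p. (\<Sum>i\<in>UNIV. \<alpha> i *\<^sub>R Xhat i p)
         + (\<Sum>(i, j)\<in>{(i, j). i < j}. \<beta> i j *\<^sub>R Y i j p)
         + (\<Sum>(i, j)\<in>{(i, j). i < j}. \<gamma> i j *\<^sub>R \<theta> i j p))"
      by blast
    define a b where "a = sol_a \<alpha> (skew \<gamma>)" and "b = sol_B \<alpha> (skew \<beta>) (skew \<gamma>)"
    have VF: "V = frame_field a b"
      unfolding V span_eq_frame_field a_def b_def ..
    have smooth: "smooth (a i)" "smooth (b i j)" for i j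
      by (simp_all add: a_def b_def smooth_sol_a smooth_sol_B)
    have skewb: "b j i p = - b i j p" for i j p
      unfolding b_def by (rule sol_B_skew) (rule skew_commute)
    have "skew (\<lambda>i j. b i j p) i j = b i j p" for i j p
      using skewb[of i j p] by (cases i j rule: linorder_cases) (simp_all add: skew_less skew_greater)
    then have V': "V = (\<lambda>p. (\<Sum>i\<in>UNIV. a i p *\<^sub>R X i p) + (\<Sum>(i, j)\<in>{(i, j). i < j}. b i j p *\<^sub>R Y i j p))"
      unfolding VF frame_field_less_pairs by simp
    have comm: "commutator sub_laplacian (vf_op V) f p = 0" if "smooth f" for f p
      unfolding VF
    proof (rule determining_equations_imp_commutes[OF smooth that])
      show "Z k (a i) p = - Z i (a k) p" for k i p
        unfolding a_def Z_sol_a by (rule skew_commute)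
      show "Z k (b i j) p = \<delta> k j * a i p - \<delta> k i * a j p" for k i j p
        unfolding a_def b_def by (rule Z_sol_B)
      have "Z k (a i) = (\<lambda>_. skew \<gamma> i k)" for k i
        unfolding a_def by (rule ext) (rule Z_sol_a)
      then show "Z k (Z k (a i)) p = 0" for k i p
        by (simp add: vf_op_const)
    qed
    show "V \<in> T"
      unfolding T_def mem_Collect_eq
    proof (intro conjI exI[of _ a] exI[of _ b] allI impI)
      show "commutator sub_laplacian (vf_op V) f = (\<lambda>p. 0)" if "smooth f" for f
        using comm[OF that] by (simp add: fun_eq_iff)
    qed (rule smooth V')+
  qed
qed

end
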